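(* Let $\mathfrak{h}_2$ be the $4$-dimensional complex Lie algebra with basis $e_1,e_2,e_3,e_4$ and only nonzero brackets (up to antisymmetry) $[e_1,e_2]=e_3$, $[e_1,e_3]=e_4$. Every Novikov algebra over $\mathbb{C}$ whose associated Lie algebra is isomorphic to $\mathfrak{h}_2$ is isomorphic to exactly one algebra in the following list. Each algebra has basis $e_1,e_2,e_3,e_4$; only nonzero products are listed (all products $e_ie_j$ not listed are zero); $\alpha$ ranges over $\mathbb{C}$, and different values of $\alpha$ give non-isomorphic algebras. - $N_1$: $e_1e_2=e_3$, $e_1e_3=e_4$. - $N_2$: $e_1e_1=e_2$, $e_1e_2=e_3$, $e_1e_3=e_4$. - $N_3$: $e_1e_2=e_3+e_4$, $e_1e_3=e_4$, $e_2e_1=e_4$. - $N_4$: $e_1e_1=e_2$, $e_1e_2=e_3+e_4$, $e_1e_3=e_4$, $e_2e_1=e_4$. - $N_5$: $e_1e_3=\tfrac12e_4$, $e_2e_1=-e_3$, $e_3e_1=-\tfrac12e_4$. - $N_6$: $e_1e_1=e_4$, $e_1e_3=\tfrac12e_4$, $e_2e_1=-e_3$, $e_3e_1=-\tfrac12e_4$. - $N_7$: $e_1e_1=e_2$, $e_1e_3=\tfrac12e_4$, $e_2e_1=-e_3$, $e_3e_1=-\tfrac12e_4$. - $N_8(\alpha)$: $e_1e_1=(2\alpha^2+\alpha)e_2$, $e_1e_2=(2\alpha+1)e_3$, $e_1e_3=(\alpha+1)e_4$, $e_2e_1=2\alpha e_3$, $e_2e_2=e_4$, $e_3e_1=\alpha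 e_4$. - $N_9$: $e_1e_1=e_3$, $e_1e_2=e_3$, $e_1e_3=e_4$, $e_2e_2=e_4$. - $N_{11}$: $e_1e_1=e_3$, $e_1e_3=\tfrac12e_4$, $e_2e_1=-e_3$, $e_2e_2=e_4$, $e_3e_1=-\tfrac12e_4$. - $N_{12}$: $e_1e_1=e_4$, $e_1e_2=e_3$, $e_1e_3=e_4$, $e_2e_2=2e_3$, $e_2e_3=e_4$, $e_3e_2=e_4$. - $N_{13}$: $e_1e_2=e_3$, $e_1e_3=e_4$, $e_2e_2=2e_3$, $e_2e_3=e_4$, $e_3e_2=e_4$. - $N_{14}(\alpha)$: $e_1e_1=\alpha e_4$, $e_1e_2=e_3$, $e_1e_3=e_4$, $e_2e_2=2e_3+e_4$, $e_2e_3=e_4$, $e_3e_2=e_4$. - $N_{15}$: $e_1e_1=e_1$, $e_1e_2=e_2+e_3$, $e_1e_3=e_3+e_4$, $e_1e_4=e_4$, $e_2e_1=e_2$, $e_3e_1=e_3$, $e_4e_1=e_4$. - $N_{16}$: $e_1e_1=e_1$, $e_1e_2=e_2+e_3$, $e_1e_3=e_3+e_4$, $e_1e_4=e_4$, $e_2e_1=e_2$, $e_2e_2=e_4$, $e_3e_1=e_3$, $e_4e_1=e_4$. - $N_{17}(\alpha)$: $e_1e_1=e_1$, $e_1e_2=e_2+e_3$, $e_1e_3=e_3+e_4$, $e_1e_4=e_4$, $e_2e_1=e_2$, $e_2e_2=2e_3+\alpha e_4$, $e_2e_3=e_4$, $e_3e_1=e_3$, $e_3e_2=e_4$, $e_4e_1=e_4$.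 Conversely, every algebra in the list is a Novikov algebra with associated Lie algebra $\mathfrak{h}_2$.
   Context: A Novikov algebra over a field $F$ is an $F$-vector space $A$ with a bilinear product $(x,y)\mapsto x\cdot y$ (also written $xy$) satisfying, for all $x,y,z\in A$, $x\cdot(y\cdot z)-(x\cdot y)\cdot z=y\cdot(x\cdot z)-(y\cdot x)\cdot z$ and $(x\cdot y)\cdot z=(x\cdot z)\cdot y$. Its associated Lie algebra is the vector space $A$ with bracket $[x,y]=x\cdot y-y\cdot x$. Isomorphism means isomorphism of algebras. The numbering of the list skips $10$, as in the source. *)

theory Defs
  imports "HOL-Analysis.Analysis"
begin

locale novikov_algebra = vector_space scale
  for scale :: "'f::field \<Rightarrow> 'a::ab_group_add \<Rightarrow> 'a" +
  fixes mul :: "'a \<Rightarrow> 'a \<Rightarrow> 'a"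
  assumes linear_mult_left: "Vector_Spaces.linear scale scale (\<lambda>x. mul x y)"
    and linear_mult_right: "Vector_Spaces.linear scale scale (\<lambda>y. mul x y)"
    and left_symmetric:
      "mul x (mul y z) - mul (mul x y) z = mul y (mul x z) - mul (mul y x) z"
    and right_commutative: "mul (mul x y) z = mul (mul x z) y"

definition lie_bracket :: "('a::ab_group_add \<Rightarrow> 'a \<Rightarrow> 'a) \<Rightarrow> 'a \<Rightarrow> 'a \<Rightarrow> 'a" where
  "lie_bracket mul x y = mul x y - mul y x"

definition algebra_isomorphic ::
  "('f::field \<Rightarrow> 'a::ab_group_add \<Rightarrow> 'a) \<Rightarrow> ('a \<Rightarrow> 'a \<Rightarrow> 'a) \<Rightarrow>
   ('f \<Rightarrow> 'b::ab_group_add \<Rightarrow> 'b) \<Rightarrow> ('b \<Rightarrow> 'b \<Rightarrow> 'b) \<Rightarrow> bool" where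
  "algebra_isomorphic s1 m1 s2 m2 \<longleftrightarrow>
     (\<exists>\<phi>. Vector_Spaces.linear s1 s2 \<phi> \<and> bij \<phi> \<and> (\<forall>x y. \<phi> (m1 x y) = m2 (\<phi> x) (\<phi> y)))"

text \<open>The index type \<open>4\<close> has exactly the elements \<open>1, 2, 3, 4\<close> (with \<open>4 = 0\<close>);
  \<open>eb 1, \<dots>, eb 4\<close> is the standard basis.\<close>

abbreviation eb :: "4 \<Rightarrow> complex ^ 4" where
  "eb i \<equiv> axis i 1"

text \<open>An entry \<open>(i, j, v)\<close> of a table stands for \<open>eb i \<cdot> eb j = v\<close>. A pair of indices occurs at most
  once in each table below; the product of \<open>eb i\<close> and \<open>eb j\<close> is zero if \<open>(i, j)\<close> does not occur.\<close>

type_synonym mult_table = "(4 \<times> 4 \<times> (complex ^ 4)) list"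

definition table_mult :: "mult_table \<Rightarrow> complex ^ 4 \<Rightarrow> complex ^ 4 \<Rightarrow> complex ^ 4" where
  "table_mult T x y = (\<Sum>(i, j, v)\<leftarrow>T. (x $ i * y $ j) *s v)"

definition h2_bracket :: "complex ^ 4 \<Rightarrow> complex ^ 4 \<Rightarrow> complex ^ 4" where
  "h2_bracket = table_mult
     [(1, 2, eb 3), (2, 1, - eb 3), (1, 3, eb 4), (3, 1, - eb 4)]"

datatype novikov_label =
    N1 | N2 | N3 | N4 | N5 | N6 | N7 | N8 complex | N9
  | N11 | N12 | N13 | N14 complex | N15 | N16 | N17 complex

fun novikov_table :: "novikov_label \<Rightarrow> mult_table" where
  "novikov_table N1 = [(1, 2, eb 3), (1, 3, eb 4)]"
| "novikov_table N2 = [(1, 1, eb 2), (1, 2, eb 3), (1, 3, eb 4)]"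
| "novikov_table N3 = [(1, 2, eb 3 + eb 4), (1, 3, eb 4), (2, 1, eb 4)]"
| "novikov_table N4 = [(1, 1, eb 2), (1, 2, eb 3 + eb 4), (1, 3, eb 4), (2, 1, eb 4)]"
| "novikov_table N5 = [(1, 3, (1/2) *s eb 4), (2, 1, - eb 3), (3, 1, (-1/2) *s eb 4)]"
| "novikov_table N6 =
     [(1, 1, eb 4), (1, 3, (1/2) *s eb 4), (2, 1, - eb 3), (3, 1, (-1/2) *s eb 4)]"
| "novikov_table N7 =
     [(1, 1, eb 2), (1, 3, (1/2) *s eb 4), (2, 1, - eb 3), (3, 1, (-1/2) *s eb 4)]"
| "novikov_table (N8 \<alpha>) =
     [(1, 1, (2 * \<alpha>\<^sup>2 + \<alpha>) *s eb 2), (1, 2, (2 * \<alpha> + 1) *s eb 3), (1, 3, (\<alpha> + 1) *s eb 4),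
      (2, 1, (2 * \<alpha>) *s eb 3), (2, 2, eb 4), (3, 1, \<alpha> *s eb 4)]"
| "novikov_table N9 = [(1, 1, eb 3), (1, 2, eb 3), (1, 3, eb 4), (2, 2, eb 4)]"
| "novikov_table N11 =
     [(1, 1, eb 3), (1, 3, (1/2) *s eb 4), (2, 1, - eb 3), (2, 2, eb 4), (3, 1, (-1/2) *s eb 4)]"
| "novikov_table N12 =
     [(1, 1, eb 4), (1, 2, eb 3), (1, 3, eb 4), (2, 2, 2 *s eb 3), (2, 3, eb 4), (3, 2, eb 4)]"
| "novikov_table N13 =
     [(1, 2, eb 3), (1, 3, eb 4), (2, 2, 2 *s eb 3), (2, 3, eb 4), (3, 2, eb 4)]"
| "novikov_table (N14 \<alpha>) =
     [(1, 1, \<alpha> *s eb 4), (1, 2, eb 3), (1, 3, eb 4), (2, 2, 2 *s eb 3 + eb 4),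
      (2, 3, eb 4), (3, 2, eb 4)]"
| "novikov_table N15 =
     [(1, 1, eb 1), (1, 2, eb 2 + eb 3), (1, 3, eb 3 + eb 4), (1, 4, eb 4),
      (2, 1, eb 2), (3, 1, eb 3), (4, 1, eb 4)]"
| "novikov_table N16 =
     [(1, 1, eb 1), (1, 2, eb 2 + eb 3), (1, 3, eb 3 + eb 4), (1, 4, eb 4),
      (2, 1, eb 2), (2, 2, eb 4), (3, 1, eb 3), (4, 1, eb 4)]"
| "novikov_table (N17 \<alpha>) =
     [(1, 1, eb 1), (1, 2, eb 2 + eb 3), (1, 3, eb 3 + eb 4), (1, 4, eb 4),
      (2, 1, eb 2), (2, 2, 2 *s eb 3 + \<alpha> *s eb 4), (2, 3, eb 4),
      (3, 1, eb 3), (3, 2, eb 4), (4, 1, eb 4)]"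

definition novikov_mult :: "novikov_label \<Rightarrow> complex ^ 4 \<Rightarrow> complex ^ 4 \<Rightarrow> complex ^ 4" where
  "novikov_mult N = table_mult (novikov_table N)"

end

theory Submission
  imports Defs
begin

text \<open>
  Write \<open>e\<^sub>1, \<dots>, e\<^sub>4\<close> for the standard basis. The proof has two halves.

  The first half restricts the product. Multiplication by a central element of the Lie algebra commutes
  with brackets (\<open>centroid_modulo\<close>), and multiplication by a bracket has trace zero
  (\<open>trace_left_mult_bracket\<close>). Applied to \<open>e\<^sub>4\<close>, and then to \<open>e\<^sub>3\<close> modulo \<open>e\<^sub>4\<close>, these facts show that
  \<open>\<langle>e\<^sub>4\<rangle>\<close> and \<open>\<langle>e\<^sub>3, e\<^sub>4\<rangle>\<close> are ideals of the Novikov algebra. Comparing coefficients in the Novikov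
  identities determines most of the other structure constants, and there remains a family with eight
  parameters subject to two equations (\<open>novikov_h2_eq_coeff_mult\<close>, with \<open>coeff_mult\<close> and
  \<open>novikov_coeffs\<close>).

  The second half sorts this family up to isomorphism. An isomorphism between two members preserves the
  commutator, so it is an automorphism of the Lie algebra; these form an explicit group with the seven
  parameters \<open>A, \<dots>, G\<close> (\<open>h2_automorphism_form\<close>). Thus two members are isomorphic precisely if their
  parameters are related by an explicit base change (\<open>coeff_mult_isomorphic_iff\<close>, with \<open>rebase\<close>). Every
  admissible parameter vector can be moved to an entry of the list (\<open>exists_label\<close>), and no base change
  leads from one entry to another (\<open>rebase_label_coeffs_imp_eq\<close>). The case distinction is governed by \<open>u\<close>
  (zero exactly if the algebra is nilpotent), \<open>t\<close> and \<open>n\<close>, which are only rescaled by base changes, and by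
  \<open>s\<close>, which is invariant if \<open>t = 0\<close>.
\<close>

section \<open>Bilinear products on four-dimensional space\<close>

definition vec4 :: "complex \<Rightarrow> complex \<Rightarrow> complex \<Rightarrow> complex \<Rightarrow> complex ^ 4" where
  "vec4 a b c d = a *s eb 1 + b *s eb 2 + c *s eb 3 + d *s eb 4"

lemma vec4_nth [simp]:
  "vec4 a b c d $ 1 = a" "vec4 a b c d $ 2 = b" "vec4 a b c d $ 3 = c" "vec4 a b c d $ 4 = d"
  by (simp_all add: vec4_def axis_def)

lemma vec4_eq_iff: "x = y \<longleftrightarrow> x $ 1 = y $ 1 \<and> x $ 2 = y $ 2 \<and> x $ 3 = y $ 3 \<and> x $ 4 = y $ 4"
  for x y :: "complex ^ 4"
  by (simp add: vec_eq_iff forall_4)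

lemma eb_nth [simp]:
  "eb 1 $ 1 = 1" "eb 1 $ 2 = 0" "eb 1 $ 3 = 0" "eb 1 $ 4 = 0"
  "eb 2 $ 1 = 0" "eb 2 $ 2 = 1" "eb 2 $ 3 = 0" "eb 2 $ 4 = 0"
  "eb 3 $ 1 = 0" "eb 3 $ 2 = 0" "eb 3 $ 3 = 1" "eb 3 $ 4 = 0"
  "eb 4 $ 1 = 0" "eb 4 $ 2 = 0" "eb 4 $ 3 = 0" "eb 4 $ 4 = 1"
  by (simp_all add: axis_def)

lemma linear_vec_iff:
  "Vector_Spaces.linear (*s) (*s) f \<longleftrightarrow>
    (\<forall>x y. f (x + y) = f x + f y) \<and> (\<forall>c x. f (c *s x) = c *s f x)"
  for f :: "complex ^ 4 \<Rightarrow> complex ^ 4"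
  unfolding Vector_Spaces.linear_iff using vec.vector_space_axioms by blast

lemma bilinear_eq_on_basis:
  fixes f g :: "complex ^ 4 \<Rightarrow> complex ^ 4 \<Rightarrow> complex ^ 4"
  assumes f: "\<And>z. Vector_Spaces.linear (*s) (*s) (\<lambda>x. f x z)" "\<And>x. Vector_Spaces.linear (*s) (*s) (f x)"
    and g: "\<And>z. Vector_Spaces.linear (*s) (*s) (\<lambda>x. g x z)" "\<And>x. Vector_Spaces.linear (*s) (*s) (g x)"
    and eq: "\<And>i j. f (eb i) (eb j) = g (eb i) (eb j)"
  shows "f = g"
proof (intro ext)
  fix x z
  have *: "h = h'" if "Vector_Spaces.linear (*s) (*s) h" "Vector_Spaces.linear (*s) (*s) h'"
    "\<And>i. h (eb i) = h' (eb i)" for h h' :: "complex ^ 4 \<Rightarrow> complex ^ 4"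
  proof
    fix v
    have "h v $ k = h' v $ k" for k
      unfolding linear_componentwise[OF that(1), of v] linear_componentwise[OF that(2), of v] that(3) ..
    then show "h v = h' v"
      by (simp add: vec_eq_iff)
  qed
  have "f (eb i) = g (eb i)" for i
    by (rule *[OF f(2) g(2) eq])
  then have "(\<lambda>x. f x z) = (\<lambda>x. g x z)" for z
    by (intro *[OF f(1) g(1)]) simp
  then show "f x z = g x z" by meson
qed

lemma h2_bracket_eq:
  "h2_bracket x y =
    vec4 0 0 (x $ 1 * y $ 2 - x $ 2 * y $ 1) (x $ 1 * y $ 3 - x $ 3 * y $ 1)"
  by (simp add: h2_bracket_def table_mult_def vec4_eq_iff)

section \<open>Isomorphism of algebras\<close>

lemma algebra_isomorphic_sym:
  assumes "algebra_isomorphic s1 m1 s2 m2"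
  shows "algebra_isomorphic s2 m2 s1 m1"
proof -
  obtain \<phi> where lin: "Vector_Spaces.linear s1 s2 \<phi>" and "bij \<phi>"
    and hom: "\<And>x y. \<phi> (m1 x y) = m2 (\<phi> x) (\<phi> y)"
    using assms unfolding algebra_isomorphic_def by blast
  interpret lin: Vector_Spaces.linear s1 s2 \<phi> by (fact lin)
  have inv1: "inv \<phi> (\<phi> x) = x" and inv2: "\<phi> (inv \<phi> z) = z" for x z
    using \<open>bij \<phi>\<close> by (simp_all add: bij_is_inj bij_is_surj surj_f_inv_f)
  have "Vector_Spaces.linear s2 s1 (inv \<phi>)"
    unfolding Vector_Spaces.linear_iff
  proof (intro conjI allI)
    show "inv \<phi> (x + y) = inv \<phi> x + inv \<phi> y" for x y
      by (metis inv1 inv2 lin.add)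
    show "inv \<phi> (s2 c x) = s1 c (inv \<phi> x)" for c x
      by (metis inv1 inv2 lin.scale)
  qed (fact lin.vs2.vector_space_axioms lin.vs1.vector_space_axioms)+
  moreover have "inv \<phi> (m2 x y) = m1 (inv \<phi> x) (inv \<phi> y)" for x y
    by (metis hom inv1 inv2)
  ultimately show ?thesis
    unfolding algebra_isomorphic_def using \<open>bij \<phi>\<close> bij_imp_bij_inv by blast
qed

lemma algebra_isomorphic_trans:
  assumes "algebra_isomorphic s1 m1 s2 m2" and "algebra_isomorphic s2 m2 s3 m3"
  shows "algebra_isomorphic s1 m1 s3 m3"
proof -
  obtain \<phi> \<psi> where "Vector_Spaces.linear s1 s2 \<phi>" "bij \<phi>" "\<And>x y. \<phi> (m1 x y) = m2 (\<phi> x) (\<phi> y)"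
    and "Vector_Spaces.linear s2 s3 \<psi>" "bij \<psi>" "\<And>x y. \<psi> (m2 x y) = m3 (\<psi> x) (\<psi> y)"
    using assms unfolding algebra_isomorphic_def by blast
  then show ?thesis
    unfolding algebra_isomorphic_def
    by (intro exI[of _ "\<psi> \<circ> \<phi>"]) (simp add: Vector_Spaces.linear_compose bij_comp)
qed

lemma novikov_algebra_transport:
  assumes "novikov_algebra s1 m1" and lin: "Vector_Spaces.linear s1 s2 \<phi>" and "bij \<phi>"
    and hom: "\<And>x y. \<phi> (m1 x y) = m2 (\<phi> x) (\<phi> y)"
  shows "novikov_algebra s2 m2"
proof -
  interpret novikov_algebra s1 m1 by fact
  interpret \<phi>: Vector_Spaces.linear s1 s2 \<phi> by (fact lin)
  interpret L: Vector_Spaces.linear s1 s1 "\<lambda>x. m1 x y" for y by (rule linear_mult_left)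
  interpret R: Vector_Spaces.linear s1 s1 "m1 x" for x by (rule linear_mult_right)
  have pre: "\<exists>x'. x = \<phi> x'" for x
    using \<open>bij \<phi>\<close> by (metis bij_pointE)
  show ?thesis
  proof (intro novikov_algebra.intro novikov_algebra_axioms.intro)
    fix x y z
    obtain x' y' z' where xyz: "x = \<phi> x'" "y = \<phi> y'" "z = \<phi> z'"
      using pre by meson
    show "m2 x (m2 y z) - m2 (m2 x y) z = m2 y (m2 x z) - m2 (m2 y x) z"
      unfolding xyz hom[symmetric] \<phi>.diff[symmetric] by (simp only: left_symmetric)
    show "m2 (m2 x y) z = m2 (m2 x z) y"
      unfolding xyz hom[symmetric] by (simp only: right_commutative)
  next
    fix y
    have "m2 (x + z) y = m2 x y + m2 z y" for x z
      by (metis pre hom \<phi>.add L.add)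
    moreover have "m2 (s2 c x) y = s2 c (m2 x y)" for c x
      by (metis pre hom \<phi>.scale L.scale)
    ultimately show "Vector_Spaces.linear s2 s2 (\<lambda>x. m2 x y)"
      unfolding Vector_Spaces.linear_iff using \<phi>.vs2.vector_space_axioms by blast
    have "m2 y (x + z) = m2 y x + m2 y z" for x z
      by (metis pre hom \<phi>.add R.add)
    moreover have "m2 y (s2 c x) = s2 c (m2 y x)" for c x
      by (metis pre hom \<phi>.scale R.scale)
    ultimately show "Vector_Spaces.linear s2 s2 (m2 y)"
      unfolding Vector_Spaces.linear_iff using \<phi>.vs2.vector_space_axioms by blast
  qed (rule \<phi>.vs2.vector_space_axioms)
qed

section \<open>The eight-parameter family\<close>

text \<open>The eight constants \<open>u s t b n p q y\<close> that survive in a Novikov product whose commutator is the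
  bracket of \<open>h2\<close>: the product by \<open>e\<^sub>1\<close> is \<open>u\<close> times the identity up to nilpotent terms, \<open>s\<close> and \<open>t\<close>
  are the \<open>e\<^sub>4\<close>-coefficients of \<open>e\<^sub>3e\<^sub>1\<close> and \<open>e\<^sub>3e\<^sub>2\<close>, \<open>b\<close>, \<open>p\<close>, \<open>q\<close> are the remaining coefficients of
  \<open>e\<^sub>1e\<^sub>1\<close>, and \<open>n\<close>, \<open>y\<close> are the \<open>e\<^sub>4\<close>-coefficients of \<open>e\<^sub>2e\<^sub>2\<close> and \<open>e\<^sub>2e\<^sub>1\<close>. The coefficient of \<open>e\<^sub>3\<close> in
  \<open>e\<^sub>2e\<^sub>1\<close> is forced to be \<open>2s\<close>, and in \<open>e\<^sub>2e\<^sub>2\<close> it is forced to be \<open>2t\<close>.\<close>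

datatype coeffs = Coeffs complex complex complex complex complex complex complex complex

fun coeff_mult :: "coeffs \<Rightarrow> complex ^ 4 \<Rightarrow> complex ^ 4 \<Rightarrow> complex ^ 4" where
  "coeff_mult (Coeffs u s t b n p q y) x z = vec4
     (u * (x $ 1 * z $ 1))
     (b * (x $ 1 * z $ 1) + u * (x $ 1 * z $ 2 + x $ 2 * z $ 1))
     (p * (x $ 1 * z $ 1) + (2 * s + 1) * (x $ 1 * z $ 2) + 2 * s * (x $ 2 * z $ 1)
       + 2 * t * (x $ 2 * z $ 2) + u * (x $ 1 * z $ 3 + x $ 3 * z $ 1))
     (q * (x $ 1 * z $ 1) + y * (x $ 1 * z $ 2 + x $ 2 * z $ 1) + n * (x $ 2 * z $ 2)
       + (s + 1) * (x $ 1 * z $ 3) + s * (x $ 3 * z $ 1)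
       + t * (x $ 2 * z $ 3 + x $ 3 * z $ 2) + u * (x $ 1 * z $ 4 + x $ 4 * z $ 1))"

text \<open>After the shape of the product is fixed, these two equations are all that remains of the two Novikov
  identities. The first is right commutativity of \<open>(e\<^sub>1e\<^sub>1)e\<^sub>3\<close>, the second that of \<open>(e\<^sub>1e\<^sub>1)e\<^sub>2\<close>.\<close>

fun novikov_coeffs :: "coeffs \<Rightarrow> bool" where
  "novikov_coeffs (Coeffs u s t b n p q y) \<longleftrightarrow>
     b * t = u * s \<and> b * n + p * t = s * (2 * s + 1) + u * y"

fun label_coeffs :: "novikov_label \<Rightarrow> coeffs" where
  "label_coeffs N1 = Coeffs 0 0 0 0 0 0 0 0"
| "label_coeffs N2 = Coeffs 0 0 0 1 0 0 0 0"
| "label_coeffs N3 = Coeffs 0 0 0 0 0 0 0 1"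
| "label_coeffs N4 = Coeffs 0 0 0 1 0 0 0 1"
| "label_coeffs N5 = Coeffs 0 (-1/2) 0 0 0 0 0 0"
| "label_coeffs N6 = Coeffs 0 (-1/2) 0 0 0 0 1 0"
| "label_coeffs N7 = Coeffs 0 (-1/2) 0 1 0 0 0 0"
| "label_coeffs (N8 \<alpha>) = Coeffs 0 \<alpha> 0 (2 * \<alpha>\<^sup>2 + \<alpha>) 1 0 0 0"
| "label_coeffs N9 = Coeffs 0 0 0 0 1 1 0 0"
| "label_coeffs N11 = Coeffs 0 (-1/2) 0 0 1 1 0 0"
| "label_coeffs N12 = Coeffs 0 0 1 0 0 0 1 0"
| "label_coeffs N13 = Coeffs 0 0 1 0 0 0 0 0"
| "label_coeffs (N14 \<alpha>) = Coeffs 0 0 1 0 1 0 \<alpha> 0"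
| "label_coeffs N15 = Coeffs 1 0 0 0 0 0 0 0"
| "label_coeffs N16 = Coeffs 1 0 0 0 1 0 0 0"
| "label_coeffs (N17 \<alpha>) = Coeffs 1 0 1 0 \<alpha> 0 0 0"

lemma novikov_mult_eq_coeff_mult: "novikov_mult N = coeff_mult (label_coeffs N)"
proof (intro ext)
  fix x y
  show "novikov_mult N x y = coeff_mult (label_coeffs N) x y"
    by (cases N) (simp_all add: novikov_mult_def table_mult_def vec4_eq_iff algebra_simps)
qed

lemma novikov_coeffs_label: "novikov_coeffs (label_coeffs N)"
  by (cases N) (simp_all add: algebra_simps power2_eq_square)

lemma lie_bracket_coeff_mult: "lie_bracket (coeff_mult P) = h2_bracket"
  by (cases P) (simp add: fun_eq_iff lie_bracket_def h2_bracket_eq vec4_eq_iff algebra_simps)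

lemma linear_coeff_mult:
  "Vector_Spaces.linear (*s) (*s) (\<lambda>x. coeff_mult P x z)"
  "Vector_Spaces.linear (*s) (*s) (coeff_mult P z)"
  by (cases P; simp add: linear_vec_iff vec4_eq_iff algebra_simps)+

lemma novikov_algebra_coeff_mult:
  assumes "novikov_coeffs P"
  shows "novikov_algebra (*s) (coeff_mult P)"
proof (cases P)
  case (Coeffs u s t b n p q y)
  have *: "b * t = u * s" "b * n + p * t = s * (2 * s + 1) + u * y"
    using assms Coeffs by auto
  show ?thesis
  proof (intro novikov_algebra.intro novikov_algebra_axioms.intro)
    fix v w z :: "complex ^ 4"
    show "Vector_Spaces.linear (*s) (*s) (\<lambda>x. coeff_mult P x z)"
      "Vector_Spaces.linear (*s) (*s) (coeff_mult P z)"
      by (fact linear_coeff_mult)+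
    show "coeff_mult P (coeff_mult P v w) z = coeff_mult P (coeff_mult P v z) w"
      unfolding Coeffs vec4_eq_iff coeff_mult.simps vec4_nth using * by (intro conjI; (algebra | simp add: algebra_simps))
    show "coeff_mult P v (coeff_mult P w z) - coeff_mult P (coeff_mult P v w) z
        = coeff_mult P w (coeff_mult P v z) - coeff_mult P (coeff_mult P w v) z"
      unfolding Coeffs vec4_eq_iff coeff_mult.simps vec4_nth vector_minus_component
      using * by (intro conjI; (algebra | simp add: algebra_simps))
  qed (rule vec.vector_space_axioms)
qed

section \<open>Every Novikov product on h2 is in the family\<close>

text \<open>If \<open>c\<close> is central in the associated Lie algebra, the Novikov identities give
  \<open>c(yz) = (cy)z = y(cz)\<close>, so that multiplication by \<open>c\<close> commutes with taking brackets (it lies in the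
  centroid of the Lie algebra). The additive map \<open>f\<close> allows \<open>c\<close> to be central only modulo an ideal, on
  which \<open>f\<close> vanishes.\<close>

lemma (in novikov_algebra) centroid_modulo:
  fixes f :: "'a \<Rightarrow> 'b :: ab_group_add"
  assumes f: "\<And>x y. f (x - y) = f x - f y"
    and comm: "\<And>x. f (mul x c) = f (mul c x)"
    and comm': "\<And>x z. f (mul (mul x c) z) = f (mul (mul c x) z)"
  shows "f (mul c (lie_bracket mul y z)) = f (lie_bracket mul (mul c y) z)"
proof -
  interpret R: Vector_Spaces.linear scale scale "mul c" by (rule linear_mult_right)
  have assoc: "f (mul c (mul y z)) = f (mul (mul c y) z)" for y z
    by (metis comm comm' right_commutative)
  have "f (mul c (mul z y)) - f (mul (mul c z) y) = f (mul z (mul c y)) - f (mul (mul z c) y)"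
    using left_symmetric[of c z y] by (metis f)
  then have "f (mul z (mul c y)) = f (mul c (mul z y))"
    by (simp add: assoc comm')
  then show ?thesis
    by (simp add: lie_bracket_def R.diff f assoc)
qed

text \<open>Left symmetry says that left multiplication is a representation of the associated Lie algebra; hence
  brackets act by commutators, which have trace zero.\<close>

lemma trace_left_mult_bracket:
  fixes m :: "complex ^ 'n \<Rightarrow> complex ^ 'n \<Rightarrow> complex ^ 'n"
  assumes "novikov_algebra (*s) m"
  shows "(\<Sum>i\<in>UNIV. m (lie_bracket m x y) (axis i 1) $ i) = 0"
proof -
  interpret novikov_algebra "(*s)" m by fact
  interpret L: Vector_Spaces.linear "(*s)" "(*s)" "\<lambda>x. m x z" for z by (rule linear_mult_left)
  have "m (lie_bracket m x y) z = m x (m y z) - m y (m x z)" for z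
    using left_symmetric[of x y z] by (simp add: lie_bracket_def L.diff algebra_simps)
  then have "(\<Sum>i\<in>UNIV. m (lie_bracket m x y) (axis i 1) $ i)
      = trace (matrix (m x \<circ> m y)) - trace (matrix (m y \<circ> m x))"
    by (simp add: trace_def matrix_def sum_subtractf)
  also have "\<dots> = 0"
    unfolding matrix_compose_gen[OF linear_mult_right linear_mult_right]
    by (subst trace_mul_sym) simp
  finally show ?thesis .
qed

text \<open>The product by the central element \<open>e\<^sub>4\<close> is in the centroid of the Lie algebra, hence a scalar plus a map
  into \<open>\<langle>e\<^sub>4\<rangle>\<close> that kills \<open>e\<^sub>3\<close> and \<open>e\<^sub>4\<close>; the scalar is zero because \<open>e\<^sub>4\<close> is a bracket and acts without trace.
  So \<open>\<langle>e\<^sub>4\<rangle>\<close> is an ideal. In the quotient \<open>e\<^sub>3\<close> is central, and the same argument applies to it.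
  What is left is a commutative associative product on \<open>\<langle>e\<^sub>1, e\<^sub>2\<rangle>\<close> modulo \<open>\<langle>e\<^sub>3, e\<^sub>4\<rangle>\<close>, acting on \<open>e\<^sub>3\<close> and \<open>e\<^sub>4\<close> through
  the characters \<open>(u', v')\<close> and \<open>(u, v)\<close>. Comparing coefficients ties these characters to the trace of
  the product on \<open>\<langle>e\<^sub>1, e\<^sub>2\<rangle>\<close>, and since they are multiplicative they must vanish on \<open>e\<^sub>2\<close> and agree on \<open>e\<^sub>1\<close>.\<close>

lemma novikov_h2_eq_coeff_mult:
  assumes "novikov_algebra (*s) m" and br: "lie_bracket m = h2_bracket"
  obtains P where "m = coeff_mult P" and "novikov_coeffs P"
proof -
  interpret novikov_algebra "(*s)" m by fact
  interpret L: Vector_Spaces.linear "(*s)" "(*s)" "\<lambda>x. m x z" for z by (rule linear_mult_left)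
  interpret R: Vector_Spaces.linear "(*s)" "(*s)" "m z" for z by (rule linear_mult_right)
  have comm: "m x y = m y x + h2_bracket x y" for x y
    by (simp add: lie_bracket_def flip: br)
  have tr: "m (h2_bracket x y) (eb 1) $ 1 + m (h2_bracket x y) (eb 2) $ 2
      + m (h2_bracket x y) (eb 3) $ 3 + m (h2_bracket x y) (eb 4) $ 4 = 0" for x y
    using trace_left_mult_bracket[OF assms(1), of x y] by (simp add: br sum_4)
  have e: "h2_bracket (eb 1) (eb 1) = 0" "h2_bracket (eb 2) (eb 2) = 0"
    "h2_bracket (eb 1) (eb 2) = eb 3" "h2_bracket (eb 2) (eb 1) = - eb 3" "h2_bracket (eb 1) (eb 3) = eb 4"
    by (simp_all add: h2_bracket_eq vec4_eq_iff)

  have comm4: "m x (eb 4) = m (eb 4) x" for x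
    using comm[of x "eb 4"] by (simp add: h2_bracket_eq vec4_eq_iff)
  have cent4: "m (eb 4) (h2_bracket y z) = h2_bracket (m (eb 4) y) z" for y z
    using centroid_modulo[of "\<lambda>x. x" "eb 4" y z] by (simp add: comm4 br)
  define u v l where "u = m (eb 4) (eb 1) $ 4" and "v = m (eb 4) (eb 2) $ 4" and "l = m (eb 4) (eb 1) $ 1"
  note cent4' = cent4[of "eb 1" "eb 1"] cent4[of "eb 2" "eb 2"] cent4[of "eb 1" "eb 2"]
    cent4[of "eb 2" "eb 1"] cent4[of "eb 1" "eb 3"]
  have 4: "m (eb 4) (eb 1) = vec4 l 0 0 u" "m (eb 4) (eb 2) = vec4 0 l 0 v"
      "m (eb 4) (eb 3) = vec4 0 0 l 0" "m (eb 4) (eb 4) = vec4 0 0 0 l"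
    using cent4' unfolding e
    by (simp_all add: h2_bracket_eq vec4_eq_iff R.zero R.neg u_def v_def l_def)
  have "l = 0"
    using tr[of "eb 1" "eb 3"] unfolding e by (simp add: 4)
  note 4 = 4[unfolded this]

  have basis: "x = x $ 1 *s eb 1 + x $ 2 *s eb 2 + x $ 3 *s eb 3 + x $ 4 *s eb 4" for x :: "complex ^ 4"
    by (simp add: vec4_eq_iff)
  have R: "m z x = x $ 1 *s m z (eb 1) + x $ 2 *s m z (eb 2) + x $ 3 *s m z (eb 3) + x $ 4 *s m z (eb 4)" for x z
    by (subst basis[of x]) (simp only: R.add R.scale)
  have L: "m x z = x $ 1 *s m (eb 1) z + x $ 2 *s m (eb 2) z + x $ 3 *s m (eb 3) z + x $ 4 *s m (eb 4) z" for x z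
    by (subst basis[of x]) (simp only: L.add L.scale)
  have e4: "m (eb 4) z = vec4 0 0 0 (u * z $ 1 + v * z $ 2)" for z
    by (subst R) (simp add: 4 vec4_eq_iff)

  have comm3: "m x (eb 3) = m (eb 3) x + x $ 1 *s eb 4" for x
    using comm[of x "eb 3"] by (simp add: h2_bracket_eq vec4_eq_iff)
  have cent3: "\<forall>k\<in>{1, 2, 3}. m (eb 3) (h2_bracket y z) $ k = h2_bracket (m (eb 3) y) z $ k" for y z
  proof
    fix k :: 4 assume that: "k \<in> {1, 2, 3}"
    have e4k: "eb 4 $ k = 0" "\<And>z. m (eb 4) z $ k = 0" using that by (auto simp: e4)
    show "m (eb 3) (h2_bracket y z) $ k = h2_bracket (m (eb 3) y) z $ k"
      using centroid_modulo[of "\<lambda>x. x $ k" "eb 3" y z]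
      by (simp add: comm3 br e4k L.add L.scale)
  qed
  define l3 u' s v' t w where "l3 = m (eb 3) (eb 1) $ 1" and "u' = m (eb 3) (eb 1) $ 3"
    and "s = m (eb 3) (eb 1) $ 4" and "v' = m (eb 3) (eb 2) $ 3" and "t = m (eb 3) (eb 2) $ 4"
    and "w = m (eb 3) (eb 3) $ 4"
  have 3: "m (eb 3) (eb 1) = vec4 l3 0 u' s" "m (eb 3) (eb 2) = vec4 0 l3 v' t"
    "m (eb 3) (eb 3) = vec4 0 0 l3 w"
    using cent3[of "eb 1" "eb 1"] cent3[of "eb 2" "eb 2"] cent3[of "eb 1" "eb 2"]
      cent3[of "eb 2" "eb 1"] unfolding e
    by (simp_all add: h2_bracket_eq vec4_eq_iff R.zero R.neg l3_def u'_def s_def v'_def t_def w_def)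
  have 34: "m (eb 3) (eb 4) = 0"
    by (simp add: comm4 e4 vec4_eq_iff)
  have "l3 = 0"
    using tr[of "eb 1" "eb 2"] unfolding e by (simp add: 3 34)
  note 3 = 3[unfolded this] 34

  define a b p q c d x y f g r n where
    "a = m (eb 1) (eb 1) $ 1" and "b = m (eb 1) (eb 1) $ 2" and "p = m (eb 1) (eb 1) $ 3" and "q = m (eb 1) (eb 1) $ 4"
    and "c = m (eb 2) (eb 1) $ 1" and "d = m (eb 2) (eb 1) $ 2" and "x = m (eb 2) (eb 1) $ 3" and "y = m (eb 2) (eb 1) $ 4"
    and "f = m (eb 2) (eb 2) $ 1" and "g = m (eb 2) (eb 2) $ 2" and "r = m (eb 2) (eb 2) $ 3" and "n = m (eb 2) (eb 2) $ 4"
  have 1: "m (eb 1) (eb 1) = vec4 a b p q" "m (eb 2) (eb 1) = vec4 c d x y" "m (eb 2) (eb 2) = vec4 f g r n"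
    by (simp_all add: vec4_eq_iff a_def b_def p_def q_def c_def d_def x_def y_def f_def g_def r_def n_def)
  have 2: "m (eb 1) (eb 2) = vec4 c d (x + 1) y"
    by (subst comm) (simp add: 1 e vec4_eq_iff)
  have 5: "m (eb 1) (eb 3) = vec4 0 0 u' (s + 1)" "m (eb 2) (eb 3) = vec4 0 0 v' t"
    by (simp_all add: comm3 3 vec4_eq_iff)
  have e4': "m z (eb 4) = vec4 0 0 0 (u * z $ 1 + v * z $ 2)" for z
    by (simp add: comm4 e4)
  note products = 1 2 3 5 e4 e4'

  have RC: "m (m (eb i) (eb j)) (eb k) $ h = m (m (eb i) (eb k)) (eb j) $ h" for i j k h
    by (simp only: right_commutative)
  have LS: "m (eb i) (m (eb j) (eb k)) $ h - m (m (eb i) (eb j)) (eb k) $ h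
      = m (eb j) (m (eb i) (eb k)) $ h - m (m (eb j) (eb i)) (eb k) $ h" for i j k h
    by (metis left_symmetric vector_minus_component)
  have Lv: "m (vec4 a b c d) z = a *s m (eb 1) z + b *s m (eb 2) z + c *s m (eb 3) z + d *s m (eb 4) z" for a b c d z
    by (subst L) simp
  have Rv: "m z (vec4 a b c d) = a *s m z (eb 1) + b *s m z (eb 2) + c *s m z (eb 3) + d *s m z (eb 4)" for a b c d z
    by (subst R) simp
  note expand = products Lv Rv

  \<comment> \<open>The trace of the product on \<open>\<langle>e\<^sub>1, e\<^sub>2\<rangle>\<close> is twice the character on \<open>e\<^sub>3\<close> (\<open>u'2\<close>, \<open>v'2\<close>); the next level
    compares the characters on \<open>e\<^sub>3\<close> and on \<open>e\<^sub>4\<close> (\<open>u2\<close>, \<open>v2\<close>).\<close>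
  have "a * (x + 1) + b * r + p * v' = c * p + d * x + (x + 1) * u'"
    using RC[of 1 1 2 3] by (simp add: expand algebra_simps)
  moreover have "c * p + d * (x + 1) + x * u' - (a * x + b * r + p * v') = u'"
    using LS[of 1 2 1 3] by (simp add: expand algebra_simps)
  ultimately have u'2: "a + d = 2 * u'" by algebra
  have "c * (x + 1) + d * r + x * v' = f * p + g * x + r * u'"
    using RC[of 2 1 2 3] by (simp add: expand algebra_simps)
  moreover have "f * p + g * (x + 1) + r * u' - (c * x + d * r + (x + 1) * v') = v'"
    using LS[of 1 2 2 3] by (simp add: expand algebra_simps)
  ultimately have v'2: "c + g = 2 * v'" by algebra
  have RC113: "a * (s + 1) + b * t + p * w = u' * s + (s + 1) * u"
    using RC[of 1 1 3 4] by (simp add: expand algebra_simps)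
  moreover have "u' * (s + 1) + s * u - (a * s + b * t + p * w) = u"
    using LS[of 1 3 1 4] by (simp add: expand algebra_simps)
  ultimately have u2: "2 * u = a + u'" by algebra
  have RC123: "c * (s + 1) + d * t + (x + 1) * w = u' * t + (s + 1) * v"
    using RC[of 1 2 3 4] by (simp add: expand algebra_simps)
  have LS132: "v' * (s + 1) + t * u - (c * s + d * t + (x + 1) * w) = v"
    using LS[of 1 3 2 4] by (simp add: expand algebra_simps)
  have RC213: "c * (s + 1) + d * t + x * w = v' * s + t * u"
    using RC[of 2 1 3 4] by (simp add: expand algebra_simps)
  have LS231: "u' * t + s * v = c * s + d * t + x * w"
    using LS[of 2 3 1 4] by (simp add: expand algebra_simps)
  have RC223: "f * (s + 1) + g * t + r * w = v' * t + t * v"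
    using RC[of 2 2 3 4] by (simp add: expand algebra_simps)
  have LS232: "v' * t + t * v = f * s + g * t + r * w"
    using LS[of 2 3 2 4] by (simp add: expand algebra_simps)
  have f: "f = 0" using RC223 LS232 by algebra
  have "c = v' * s + t * u - u' * t - s * v" using RC213 LS231 by algebra
  moreover have "v' + c + (v' * s + t * u - u' * t - s * v) = 2 * v" using RC123 LS132 by algebra
  ultimately have v2: "v' + 2 * c = 2 * v" by algebra
  \<comment> \<open>Multiplicativity of the characters, and associativity on \<open>\<langle>e\<^sub>1, e\<^sub>2\<rangle>\<close>.\<close>
  have v'g: "g * v' = v' * v'"
    using RC[of 2 2 3 3] f by (simp add: expand algebra_simps)
  have vg: "g * v = v * v"
    using RC[of 2 2 4 4] f by (simp add: expand algebra_simps)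
  have cg: "c * c = g * c"
    using RC[of 2 1 2 1] f by (simp add: expand algebra_simps)
  have v': "v' = 0"
  proof (rule ccontr)
    assume "v' \<noteq> 0"
    then have "g = v'" using v'g by simp
    then have "c = v'" using v'2 by simp
    then have "3 * v' = 2 * v" using v2 by simp
    moreover have "v = 0 \<or> v = v'" using vg \<open>g = v'\<close> by auto
    ultimately show False using \<open>v' \<noteq> 0\<close> by auto
  qed
  have "c * c = 0" using v'2 cg v' by algebra
  then have c: "c = 0" by simp
  then have g: "g = 0" and v: "v = 0" using v'2 v2 v' by simp_all
  have ad: "a * d = d * d"
    using RC[of 1 1 2 2] g c by (simp add: expand algebra_simps)
  have u'a: "a * u' = u' * u'"
    using RC[of 1 1 3 3] v' c by (simp add: expand algebra_simps)
  have d: "d = a" and u': "u' = a" and u: "u = a"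
  proof -
    have "d = a"
    proof (rule ccontr)
      assume "d \<noteq> a"
      then have "d = 0" using ad by simp
      then have "a = 2 * u'" using u'2 by simp
      then have "u' * u' = 0" using u'a by algebra
      then show False using \<open>d = 0\<close> \<open>a = 2 * u'\<close> \<open>d \<noteq> a\<close> by simp
    qed
    then show "d = a" "u' = a" using u'2 by simp_all
    then show "u = a" using u2 by simp
  qed
  have w: "w = 0" using RC123 LS231 c d u' v by algebra
  note zero = f c g v v' w d u u'
  have RC112: "a * y + b * n + p * t = a * y + (x + 1) * s + y * a"
    using RC[of 1 1 2 4] zero by (simp add: expand algebra_simps)
  moreover have "a * y + x * (s + 1) + y * a - (a * y + b * n + p * t) = s"
    using LS[of 1 2 1 4] zero by (simp add: expand algebra_simps)
  ultimately have x: "x = 2 * s" by algebra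
  have "r * s + r - (x * t + t) = t"
    using LS[of 1 2 2 4] zero by (simp add: expand algebra_simps)
  moreover have "x * t = r * s"
    using RC[of 2 1 2 4] zero by (simp add: expand algebra_simps)
  ultimately have "r = t + t" by (simp add: diff_eq_eq)
  then have r: "r = 2 * t" by simp
  have bt: "b * t = a * s" using RC113 zero by algebra
  have bn: "b * n + p * t = s * (2 * s + 1) + a * y" using RC112 x by algebra
  let ?P = "Coeffs a s t b n p q y"
  note products = products[unfolded zero x r]
  have "m (eb i) (eb j) = coeff_mult ?P (eb i) (eb j)" for i j
    using exhaust_4[of i] exhaust_4[of j] by (elim disjE) (simp_all add: products vec4_eq_iff)
  then have "m = coeff_mult ?P"
    by (intro bilinear_eq_on_basis linear_mult_left linear_mult_right linear_coeff_mult)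
  moreover have "novikov_coeffs ?P"
    using bt bn by simp
  ultimately show ?thesis by (rule that)
qed

section \<open>Base changes\<close>

text \<open>Suppose that \<open>P\<close> gives the structure constants in the basis \<open>e\<^sub>i\<close>. Then \<open>P'\<close> gives those in the basis
  \<open>e\<^sub>1' = A e\<^sub>1 + B e\<^sub>2 + C e\<^sub>3 + D e\<^sub>4\<close>, \<open>e\<^sub>2' = E e\<^sub>2 + F e\<^sub>3 + G e\<^sub>4\<close>, \<open>e\<^sub>3' = [e\<^sub>1', e\<^sub>2']\<close>, \<open>e\<^sub>4' = [e\<^sub>1', e\<^sub>3']\<close>.
  The equations are kept free of denominators; read in the given order they determine \<open>P'\<close> from \<open>P\<close>.\<close>

fun rebase :: "complex \<Rightarrow> complex \<Rightarrow> complex \<Rightarrow> complex \<Rightarrow> complex \<Rightarrow> complex \<Rightarrow> complex \<Rightarrow>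
    coeffs \<Rightarrow> coeffs \<Rightarrow> bool" where
  "rebase A B C D E F G (Coeffs u s t b n p q y) (Coeffs u' s' t' b' n' p' q' y') \<longleftrightarrow>
     A \<noteq> 0 \<and> E \<noteq> 0 \<and>
     u' = A * u \<and>
     A * t' = E * t \<and>
     A * s' = A * s + B * t \<and>
     A\<^sup>2 * n' = E * n \<and>
     E * b' = A\<^sup>2 * b + A * B * u \<and>
     A * E * p' = A\<^sup>2 * p + A * B * (4 * s + 1) + 2 * B\<^sup>2 * t + A * C * u - F * b' \<and>
     A\<^sup>2 * E * q' = A\<^sup>2 * q + 2 * A * B * y + B\<^sup>2 * n + A * C * (2 * s + 1) + 2 * B * C * t
       + A * D * u - G * b' - A * F * p' \<and>
     A\<^sup>2 * E * y' = A * E * y + B * E * n + C * E * t - A * F * s - B * F * t"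

text \<open>The linear map that sends \<open>e\<^sub>i\<close> to the vector \<open>e\<^sub>i'\<close> of the new basis described above.\<close>

definition base_map :: "complex \<Rightarrow> complex \<Rightarrow> complex \<Rightarrow> complex \<Rightarrow> complex \<Rightarrow> complex \<Rightarrow> complex \<Rightarrow>
    complex ^ 4 \<Rightarrow> complex ^ 4" where
  "base_map A B C D E F G x = vec4 (A * x $ 1) (B * x $ 1 + E * x $ 2)
     (C * x $ 1 + F * x $ 2 + A * E * x $ 3)
     (D * x $ 1 + G * x $ 2 + A * F * x $ 3 + A\<^sup>2 * E * x $ 4)"

lemma linear_base_map: "Vector_Spaces.linear (*s) (*s) (base_map A B C D E F G)"
  by (simp add: linear_vec_iff base_map_def vec4_eq_iff algebra_simps)

lemma bij_base_map:
  assumes "A \<noteq> 0" and "E \<noteq> 0"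
  shows "bij (base_map A B C D E F G)"
proof -
  have "inj (base_map A B C D E F G)"
    using assms by (auto simp: inj_def base_map_def vec4_eq_iff)
  then show ?thesis
    using vec.linear_inj_imp_surj[OF linear_base_map] by (simp add: bij_def)
qed

text \<open>Since \<open>e\<^sub>3\<close> and \<open>e\<^sub>4\<close> are iterated brackets of \<open>e\<^sub>1\<close> and \<open>e\<^sub>2\<close>, an automorphism is determined by the images
  of these two. The image of \<open>e\<^sub>2\<close> has no \<open>e\<^sub>1\<close>-component because \<open>[e\<^sub>2, e\<^sub>3] = 0\<close> while the image of \<open>e\<^sub>4\<close> is
  nonzero.\<close>

lemma h2_automorphism_form:
  assumes lin: "Vector_Spaces.linear (*s) (*s) \<phi>" and "inj \<phi>"
    and hom: "\<And>x y. \<phi> (h2_bracket x y) = h2_bracket (\<phi> x) (\<phi> y)"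
  obtains A B C D E F G where "A \<noteq> 0" and "E \<noteq> 0" and "\<phi> = base_map A B C D E F G"
proof -
  interpret lin: Vector_Spaces.linear "(*s)" "(*s)" \<phi> by (fact lin)
  define v w where "v = \<phi> (eb 1)" and "w = \<phi> (eb 2)"
  have e: "eb 3 = h2_bracket (eb 1) (eb 2)" "eb 4 = h2_bracket (eb 1) (eb 3)"
    "0 = h2_bracket (eb 2) (eb 3)"
    by (simp_all add: h2_bracket_eq vec4_eq_iff)
  have e3: "\<phi> (eb 3) = vec4 0 0 (v $ 1 * w $ 2 - v $ 2 * w $ 1) (v $ 1 * w $ 3 - v $ 3 * w $ 1)"
    by (subst e, subst hom) (simp add: h2_bracket_eq v_def w_def)
  have e4: "\<phi> (eb 4) = vec4 0 0 0 (v $ 1 * (v $ 1 * w $ 2 - v $ 2 * w $ 1))"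
    by (subst e, subst hom) (simp add: h2_bracket_eq e3 v_def)
  have "\<phi> 0 = vec4 0 0 0 (w $ 1 * (v $ 1 * w $ 2 - v $ 2 * w $ 1))"
    by (subst e(3), subst hom) (simp add: h2_bracket_eq e3 w_def)
  then have *: "w $ 1 * (v $ 1 * w $ 2 - v $ 2 * w $ 1) = 0"
    by (simp add: lin.zero vec4_eq_iff)
  have "\<phi> (eb 4) \<noteq> \<phi> 0"
    by (subst inj_eq[OF \<open>inj \<phi>\<close>]) (auto simp: vec4_eq_iff)
  then have ne: "v $ 1 * (v $ 1 * w $ 2 - v $ 2 * w $ 1) \<noteq> 0"
    by (auto simp: e4 lin.zero vec4_eq_iff)
  with * have w1: "w $ 1 = 0" by auto
  have "\<phi> x = base_map (v $ 1) (v $ 2) (v $ 3) (v $ 4) (w $ 2) (w $ 3) (w $ 4) x" for x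
  proof -
    have "x = x $ 1 *s eb 1 + x $ 2 *s eb 2 + x $ 3 *s eb 3 + x $ 4 *s eb 4"
      by (simp add: vec4_eq_iff)
    then have "\<phi> x = \<phi> (x $ 1 *s eb 1 + x $ 2 *s eb 2 + x $ 3 *s eb 3 + x $ 4 *s eb 4)"
      by simp
    also have "\<dots> = x $ 1 *s v + x $ 2 *s w + x $ 3 *s \<phi> (eb 3) + x $ 4 *s \<phi> (eb 4)"
      by (simp add: lin.add lin.scale v_def w_def)
    also have "\<dots> = base_map (v $ 1) (v $ 2) (v $ 3) (v $ 4) (w $ 2) (w $ 3) (w $ 4) x"
      by (simp add: e3 e4 w1 base_map_def vec4_eq_iff power2_eq_square)
    finally show ?thesis .
  qed
  then have "\<phi> = base_map (v $ 1) (v $ 2) (v $ 3) (v $ 4) (w $ 2) (w $ 3) (w $ 4)" ..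
  moreover have "v $ 1 \<noteq> 0" "w $ 2 \<noteq> 0" using ne w1 by auto
  ultimately show ?thesis using that by blast
qed

text \<open>By bilinearity multiplicativity is a statement about the products of basis vectors. The products
  \<open>e\<^sub>1e\<^sub>1\<close>, \<open>e\<^sub>2e\<^sub>1\<close> and \<open>e\<^sub>2e\<^sub>2\<close> already yield all equations of \<^const>\<open>rebase\<close>, and these imply the
  multiplicativity on the other products.\<close>

lemma base_map_hom_iff_rebase:
  assumes "A \<noteq> 0" and "E \<noteq> 0"
  shows "(\<forall>x z. base_map A B C D E F G (coeff_mult P' x z)
      = coeff_mult P (base_map A B C D E F G x) (base_map A B C D E F G z))
    \<longleftrightarrow> rebase A B C D E F G P P'"
proof (cases P; cases P')
  fix u s t b n p q y u' s' t' b' n' p' q' y'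
  assume P: "P = Coeffs u s t b n p q y" and P': "P' = Coeffs u' s' t' b' n' p' q' y'"
  let ?f = "base_map A B C D E F G"
  show ?thesis
  proof
    assume hom: "\<forall>x z. ?f (coeff_mult P' x z) = coeff_mult P (?f x) (?f z)"
    note hom' = hom[rule_format, unfolded vec4_eq_iff P P' base_map_def coeff_mult.simps vec4_nth]
    have u: "u' = A * u"
      using hom'[of "eb 1" "eb 1"] assms by (simp add: algebra_simps)
    have b: "E * b' = A\<^sup>2 * b + A * B * u"
      using hom'[of "eb 1" "eb 1"] u by (simp add: algebra_simps power2_eq_square)
    have p: "A * E * p' = A\<^sup>2 * p + A * B * (4 * s + 1) + 2 * B\<^sup>2 * t + A * C * u - F * b'"
      using hom'[of "eb 1" "eb 1"] u by (simp add: algebra_simps power2_eq_square)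
    have q: "A\<^sup>2 * E * q' = A\<^sup>2 * q + 2 * A * B * y + B\<^sup>2 * n + A * C * (2 * s + 1) + 2 * B * C * t
        + A * D * u - G * b' - A * F * p'"
      using hom'[of "eb 1" "eb 1"] u by (simp add: algebra_simps power2_eq_square)
    have 22: "A * E * (2 * t') = 2 * t * (E * E)"
        "A * F * (2 * t') + A\<^sup>2 * E * n' = n * (E * E) + t * (E * F + F * E)"
      using hom'[of "eb 2" "eb 2"] by simp_all
    have "E * (A * t') = E * (E * t)"
      using 22(1) by algebra
    then have t: "A * t' = E * t" using assms by simp
    have "E * (A\<^sup>2 * n') = E * (E * n)"
      using 22(2) t by algebra
    then have n: "A\<^sup>2 * n' = E * n" using assms by simp
    have 21: "F * u' + A * E * (2 * s') = 2 * s * (E * A) + 2 * t * (E * B) + u * (F * A)"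
      "G * u' + A * F * (2 * s') + A\<^sup>2 * E * y' = y * (E * A) + n * (E * B) + s * (F * A) + t * (E * C + F * B) + u * (G * A)"
      using hom'[of "eb 2" "eb 1"] by simp_all
    have "E * (A * s') = E * (A * s + B * t)"
      using 21(1) u by algebra
    then have s: "A * s' = A * s + B * t" using assms by simp
    have y: "A\<^sup>2 * E * y' = A * E * y + B * E * n + C * E * t - A * F * s - B * F * t"
      using 21(2) u s by algebra
    show "rebase A B C D E F G P P'"
      using assms u b p q t n s y by (simp add: P P')
  next
    assume "rebase A B C D E F G P P'"
    then have *: "u' = A * u" "A * t' = E * t" "A * s' = A * s + B * t" "A\<^sup>2 * n' = E * n"
     "E * b' = A\<^sup>2 * b + A * B * u"
     "A * E * p' = A\<^sup>2 * p + A * B * (4 * s + 1) + 2 * B\<^sup>2 * t + A * C * u - F * b'"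
     "A\<^sup>2 * E * q' = A\<^sup>2 * q + 2 * A * B * y + B\<^sup>2 * n + A * C * (2 * s + 1) + 2 * B * C * t
       + A * D * u - G * b' - A * F * p'"
     "A\<^sup>2 * E * y' = A * E * y + B * E * n + C * E * t - A * F * s - B * F * t"
      by (simp_all add: P P')
    have basis: "?f (coeff_mult P' (eb i) (eb j)) = coeff_mult P (?f (eb i)) (?f (eb j))" for i j
    proof -
      note e = P P' base_map_def vec4_eq_iff
      have 11: "?f (coeff_mult P' (eb 1) (eb 1)) = coeff_mult P (?f (eb 1)) (?f (eb 1))"
      proof -
        have "A * u' = u * (A * A)" using *(1) by algebra
        moreover have "B * u' + E * b' = b * (A * A) + u * (A * B + B * A)" using *(1,5) by algebra
        moreover have "C * u' + F * b' + A * E * p' = p * (A * A) + (2 * s + 1) * (A * B)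
            + 2 * s * (B * A) + 2 * t * (B * B) + u * (A * C + C * A)"
          using *(1,6) by algebra
        moreover have "D * u' + G * b' + A * F * p' + A\<^sup>2 * E * q' = q * (A * A) + y * (A * B + B * A)
            + n * (B * B) + (s + 1) * (A * C) + s * (C * A) + t * (B * C + C * B) + u * (A * D + D * A)"
          using *(1,7) by algebra
        ultimately show ?thesis
          unfolding e by simp
      qed
      have 12: "?f (coeff_mult P' (eb 1) (eb 2)) = coeff_mult P (?f (eb 1)) (?f (eb 2))"
        unfolding e by (simp; intro conjI disjI2; use *(1,3,8) in algebra)
      have 21: "?f (coeff_mult P' (eb 2) (eb 1)) = coeff_mult P (?f (eb 2)) (?f (eb 1))"
        unfolding e by (simp; intro conjI disjI2; use *(1,3,8) in algebra)
      have 22: "?f (coeff_mult P' (eb 2) (eb 2)) = coeff_mult P (?f (eb 2)) (?f (eb 2))"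
        unfolding e by (simp; intro conjI disjI2; use *(2,4) in algebra)
      have 13: "?f (coeff_mult P' (eb 1) (eb 3)) = coeff_mult P (?f (eb 1)) (?f (eb 3))"
        unfolding e by (simp; intro conjI disjI2; use *(1,3) in algebra)
      have 31: "?f (coeff_mult P' (eb 3) (eb 1)) = coeff_mult P (?f (eb 3)) (?f (eb 1))"
        unfolding e by (simp; intro conjI disjI2; use *(1,3) in algebra)
      have 23: "?f (coeff_mult P' (eb 2) (eb 3)) = coeff_mult P (?f (eb 2)) (?f (eb 3))"
        unfolding e by (simp; intro conjI disjI2; use *(2) in algebra)
      have 32: "?f (coeff_mult P' (eb 3) (eb 2)) = coeff_mult P (?f (eb 3)) (?f (eb 2))"
        unfolding e by (simp; intro conjI disjI2; use *(2) in algebra)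
      have 0: "?f (coeff_mult P' (eb i) (eb j)) = coeff_mult P (?f (eb i)) (?f (eb j))"
        if "(i, j) \<in> {(1,4),(4,1),(2,4),(4,2),(3,3),(3,4),(4,3),(4,4)}"
        using that unfolding e by (auto simp: *(1))
      show ?thesis
        using exhaust_4[of i] exhaust_4[of j] 11 12 21 22 13 31 23 32 0 by blast
    qed
    have "(\<lambda>x z. ?f (coeff_mult P' x z)) = (\<lambda>x z. coeff_mult P (?f x) (?f z))"
      using Vector_Spaces.linear_compose[OF linear_coeff_mult(1) linear_base_map[of A B C D E F G]]
        Vector_Spaces.linear_compose[OF linear_coeff_mult(2) linear_base_map[of A B C D E F G]]
        Vector_Spaces.linear_compose[OF linear_base_map[of A B C D E F G] linear_coeff_mult(1)]
        Vector_Spaces.linear_compose[OF linear_base_map[of A B C D E F G] linear_coeff_mult(2)]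
      by (intro bilinear_eq_on_basis basis) (simp_all add: o_def)
    then show "\<forall>x z. ?f (coeff_mult P' x z) = coeff_mult P (?f x) (?f z)"
      by meson
  qed
qed


lemma coeff_mult_isomorphic_iff:
  "algebra_isomorphic (*s) (coeff_mult P') (*s) (coeff_mult P)
    \<longleftrightarrow> (\<exists>A B C D E F G. rebase A B C D E F G P P')"
proof
  assume "algebra_isomorphic (*s) (coeff_mult P') (*s) (coeff_mult P)"
  then obtain \<phi> where lin: "Vector_Spaces.linear (*s) (*s) \<phi>" and "bij \<phi>"
    and hom: "\<And>x y. \<phi> (coeff_mult P' x y) = coeff_mult P (\<phi> x) (\<phi> y)"
    unfolding algebra_isomorphic_def by blast
  interpret lin: Vector_Spaces.linear "(*s)" "(*s)" \<phi> by (fact lin)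
  have h2: "h2_bracket x y = coeff_mult Q x y - coeff_mult Q y x" for Q x y
    by (metis lie_bracket_coeff_mult lie_bracket_def)
  have hom_h2: "\<phi> (h2_bracket x y) = h2_bracket (\<phi> x) (\<phi> y)" for x y
    unfolding h2[of x y P'] h2[of "\<phi> x" "\<phi> y" P] lin.diff hom ..
  obtain A B C D E F G where "A \<noteq> 0" "E \<noteq> 0" "\<phi> = base_map A B C D E F G"
    by (rule h2_automorphism_form[OF lin bij_is_inj[OF \<open>bij \<phi>\<close>] hom_h2])
  then have "rebase A B C D E F G P P'"
    using hom base_map_hom_iff_rebase by blast
  then show "\<exists>A B C D E F G. rebase A B C D E F G P P'" by blast
next
  assume "\<exists>A B C D E F G. rebase A B C D E F G P P'"
  then obtain A B C D E F G where *: "rebase A B C D E F G P P'" by blast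
  then have "A \<noteq> 0" "E \<noteq> 0" by (cases P; cases P'; simp)+
  then show "algebra_isomorphic (*s) (coeff_mult P') (*s) (coeff_mult P)"
    unfolding algebra_isomorphic_def
    using * by (intro exI[of _ "base_map A B C D E F G"] conjI linear_base_map bij_base_map)
      (simp_all add: base_map_hom_iff_rebase)
qed

section \<open>Normal forms\<close>

text \<open>Whether \<open>u\<close>, \<open>t\<close> and \<open>n\<close> vanish does not depend on the basis; neither does the value of \<open>s\<close> when \<open>t = 0\<close>.
  This separates the list into four groups, in which the remaining equations of \<^const>\<open>rebase\<close> are rigid
  enough to read off the label.\<close>

lemma rebase_label_coeffs_imp_eq:
  assumes "rebase A B C D E F G (label_coeffs N) (label_coeffs N')"
  shows "N = N'"
proof -
  obtain u s t b n p q y where N: "label_coeffs N = Coeffs u s t b n p q y"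
    by (cases "label_coeffs N")
  obtain u' s' t' b' n' p' q' y' where N': "label_coeffs N' = Coeffs u' s' t' b' n' p' q' y'"
    by (cases "label_coeffs N'")
  have A: "A \<noteq> 0" and E: "E \<noteq> 0" and u: "u' = A * u" and t: "A * t' = E * t"
    and s: "A * s' = A * s + B * t" and n: "A\<^sup>2 * n' = E * n"
    and b: "E * b' = A\<^sup>2 * b + A * B * u"
    and p: "A * E * p' = A\<^sup>2 * p + A * B * (4 * s + 1) + 2 * B\<^sup>2 * t + A * C * u - F * b'"
    and q: "A\<^sup>2 * E * q' = A\<^sup>2 * q + 2 * A * B * y + B\<^sup>2 * n + A * C * (2 * s + 1) + 2 * B * C * t
       + A * D * u - G * b' - A * F * p'"
    and y: "A\<^sup>2 * E * y' = A * E * y + B * E * n + C * E * t - A * F * s - B * F * t"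
    using assms by (simp_all add: N N')
  have u0: "u' = 0 \<longleftrightarrow> u = 0" and t0: "t' = 0 \<longleftrightarrow> t = 0" and n0: "n' = 0 \<longleftrightarrow> n = 0"
    using A E u t n by (metis mult_eq_0_iff power_not_zero)+
  consider "u \<noteq> 0" | "u = 0" "t \<noteq> 0" | "u = 0" "t = 0" "n \<noteq> 0" | "u = 0" "t = 0" "n = 0" by blast
  then show ?thesis
  proof cases
    case 1
    have mem: "M \<in> {N15, N16} \<union> range N17"
      if "label_coeffs M = Coeffs u s t b n p q y" "u \<noteq> 0" for M u s t b n p q y
      using that by (cases M) auto
    have "N \<in> {N15, N16} \<union> range N17" "N' \<in> {N15, N16} \<union> range N17"
      using mem N N' 1 u0 by blast+
    moreover from this have "A = 1"
      using N N' u by auto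
    ultimately show ?thesis
      using N N' t n E by auto
  next
    case 2
    have mem: "M \<in> {N12, N13} \<union> range N14"
      if "label_coeffs M = Coeffs u s t b n p q y" "u = 0" "t \<noteq> 0" for M u s t b n p q y
      using that by (cases M) auto
    have NN': "N \<in> {N12, N13} \<union> range N14" "N' \<in> {N12, N13} \<union> range N14"
      using mem N N' 2 u0 t0 by blast+
    have eq: "E = A" "B = 0" "C = 0"
      using NN' N N' t s y A by auto
    then have "A * n' = n" "A * q' = q"
      using NN' N N' n q 2 A by (auto simp: power2_eq_square)
    then show ?thesis
      using NN' N N' A by auto
  next
    case 3
    have mem: "M \<in> {N9, N11} \<union> range N8"
      if "label_coeffs M = Coeffs u s t b n p q y" "u = 0" "t = 0" "n \<noteq> 0" for M u s t b n p q y
      using that by (cases M) auto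
    have NN': "N \<in> {N9, N11} \<union> range N8" "N' \<in> {N9, N11} \<union> range N8"
      using mem N N' 3 u0 t0 n0 by blast+
    have E: "E = A\<^sup>2" and "s' = s"
      using NN' N N' n s 3 A by auto
    have "A * (A * B) = A * (F * s)"
      using NN' N N' y E 3 A by (auto simp: power2_eq_square ac_simps)
    then have B: "A * B = F * s"
      using A by simp
    have "p' = 0 \<longleftrightarrow> p = 0" if "s = 0"
      using NN' N N' that p E A B \<open>s' = s\<close> 3 by (auto simp: power2_eq_square)
    \<comment> \<open>Separates \<open>N11\<close> from \<open>N8\<close> at \<open>\<alpha> = -1/2\<close>, the one value of \<open>s\<close> at which neither \<open>C\<close> nor \<open>G\<close>
      can correct the \<open>e\<^sub>4\<close>-coefficient of \<open>e\<^sub>1e\<^sub>1\<close>.\<close>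
    moreover have "p' = 0 \<longleftrightarrow> p = 0" if "s = -1/2"
    proof -
      have p1: "A\<^sup>2 * p' = A * p - B"
      proof -
        have "A * (A\<^sup>2 * p') = A * (A * p - B)"
          using NN' N N' that p E \<open>s' = s\<close> 3 by (auto simp: power2_eq_square algebra_simps)
        then show ?thesis using A by simp
      qed
      have q1: "B\<^sup>2 = A * F * p'"
        using NN' N N' that q E \<open>s' = s\<close> 3 by (auto simp: power2_eq_square)
      have F: "F = - 2 * A * B"
        using B that by (simp add: field_simps)
      have "A ^ 4 * p'\<^sup>2 = A\<^sup>2 * p\<^sup>2"
        using p1 q1 F by algebra
      then show ?thesis using A by (metis mult_eq_0_iff power_not_zero zero_eq_power2)
    qed
    ultimately show ?thesis
      using NN' N N' \<open>s' = s\<close> by auto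
  next
    case 4
    have mem: "M \<in> {N1, N2, N3, N4, N5, N6, N7}"
      if "label_coeffs M = Coeffs u s t b n p q y" "u = 0" "t = 0" "n = 0" for M u s t b n p q y
      using that by (cases M) auto
    have NN': "N \<in> {N1, N2, N3, N4, N5, N6, N7}" "N' \<in> {N1, N2, N3, N4, N5, N6, N7}"
      using mem N N' 4 u0 t0 n0 by blast+
    have "s' = s" using s 4 A by simp
    have b0: "b' = 0 \<longleftrightarrow> b = 0"
      using b 4 A E by (metis add.right_neutral mult_eq_0_iff mult_zero_right power_not_zero)
    have y0: "y' = 0 \<longleftrightarrow> y = 0" if "s = 0"
      using y that 4 A E by auto
    have q0: "q' = 0 \<longleftrightarrow> q = 0" if "s = -1/2" "b = 0"
    proof -
      have "F = 0"
        using NN' N N' y that \<open>s' = s\<close> 4 A by auto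
      then have "B = 0"
        using NN' N N' p that \<open>s' = s\<close> 4 A by auto
      then show ?thesis
        using q that \<open>F = 0\<close> 4 A E b0 by auto
    qed
    show ?thesis
      using NN' N N' \<open>s' = s\<close> b0 y0 q0 by auto
  qed
qed

text \<open>The new basis is found by solving the equations of \<^const>\<open>rebase\<close> one after the other: \<open>B\<close>, \<open>C\<close>, \<open>D\<close>, \<open>F\<close>
  and \<open>G\<close> are used to kill coefficients and \<open>A\<close>, \<open>E\<close> to scale the surviving ones to \<open>1\<close>. The two equations
  of \<^const>\<open>novikov_coeffs\<close> make the coefficients vanish that are not within reach of the base change.\<close>

lemma exists_label:
  assumes "novikov_coeffs P"
  shows "\<exists>N A B C D E F G. rebase A B C D E F G P (label_coeffs N)"
proof (cases P)
  case P: (Coeffs u s t b n p q y)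
  have nov: "b * t = u * s" "b * n + p * t = s * (2 * s + 1) + u * y"
    using assms P by auto
  show ?thesis
  proof (cases "u = 0")
    case u: False
    \<comment> \<open>The new \<open>e\<^sub>1\<close> is made an idempotent; \<open>s\<close> and \<open>y\<close> then vanish by themselves.\<close>
    define A B C D where "A = 1 / u" and "B = - b / u\<^sup>2"
      and "C = - (A\<^sup>2 * p + A * B * (4 * s + 1) + 2 * B\<^sup>2 * t)"
      and "D = - (A\<^sup>2 * q + 2 * A * B * y + B\<^sup>2 * n + A * C * (2 * s + 1) + 2 * B * C * t)"
    have A: "A \<noteq> 0" "A * u = 1" using u by (simp_all add: A_def)
    have B: "B = - b * A\<^sup>2" by (simp add: A_def B_def power_divide)
    have "u * (A * s + B * t) = 0"
      using A nov B by algebra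
    then have s: "A * s + B * t = 0" using u by simp
    have "u\<^sup>2 * (A * y + B * n + C * t) = 0"
      using A nov B C_def by algebra
    then have y: "A * y + B * n + C * t = 0" using u by simp
    have main: "rebase A B C D E 0 0 P (Coeffs 1 0 t' 0 n' 0 0 0)"
      if "E \<noteq> 0" "A * t' = E * t" "A\<^sup>2 * n' = E * n" for E t' n'
    proof -
      have "A\<^sup>2 * b + A * B * u = 0" using A B by algebra
      moreover have "A\<^sup>2 * p + A * B * (4 * s + 1) + 2 * B\<^sup>2 * t + A * C * u = 0"
        using A C_def by algebra
      moreover have "A\<^sup>2 * q + 2 * A * B * y + B\<^sup>2 * n + A * C * (2 * s + 1) + 2 * B * C * t + A * D * u = 0"
        using A D_def by algebra
      moreover have "A * E * y + B * E * n + C * E * t = 0"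
        using y by algebra
      ultimately show ?thesis
        using that A s by (simp add: P)
    qed
    consider "t \<noteq> 0" | "t = 0" "n \<noteq> 0" | "t = 0" "n = 0" by blast
    then show ?thesis
    proof cases
      case 1
      have "rebase A B C D (A / t) 0 0 P (label_coeffs (N17 (n / (A * t))))"
        using 1 A by (auto intro!: main simp: field_simps power2_eq_square)
      then show ?thesis by blast
    next
      case 2
      have "rebase A B C D (A\<^sup>2 / n) 0 0 P (label_coeffs N16)"
        using 2 A by (auto intro!: main)
      then show ?thesis by blast
    next
      case 3
      have "rebase A B C D 1 0 0 P (label_coeffs N15)"
        using 3 by (auto intro!: main)
      then show ?thesis by blast
    qed
  next
    case u: True
    show ?thesis
    proof (cases "t = 0")
      case t: False
      have b: "b = 0" using nov u t by simp
      \<comment> \<open>\<open>B\<close> makes \<open>s\<close> vanish and \<open>C\<close> makes \<open>y\<close> vanish; \<open>Q\<close> is the resulting \<open>q\<close>. Only scalings are left.\<close>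
      define B C where "B = - s / t" and "C = - (y + B * n) / t"
      define Q where "Q = q + 2 * B * y + B\<^sup>2 * n + C * (2 * s + 1) + 2 * B * C * t"
      have B: "B * t = - s" and C: "C * t = - (y + B * n)"
        using t by (simp_all add: B_def C_def)
      have "t * (p + B * (4 * s + 1) + 2 * B\<^sup>2 * t) = 0"
        using nov u b B by algebra
      then have p: "p + B * (4 * s + 1) + 2 * B\<^sup>2 * t = 0"
        using t by simp
      have main: "rebase A (A * B) (A * C) 0 (A / t) 0 0 P (Coeffs 0 0 1 0 n' 0 q' 0)"
        if "A \<noteq> 0" "A * t * n' = n" "A * q' = Q * t" for A n' q'
      proof -
        have "A * s + A * B * t = 0" using B by algebra
        moreover have "A\<^sup>2 * n' = A / t * n"
          using that t by (auto simp: field_simps power2_eq_square)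
        moreover have "A\<^sup>2 * p + A * (A * B) * (4 * s + 1) + 2 * (A * B)\<^sup>2 * t = 0"
          using p by algebra
        moreover have "A\<^sup>2 * (A / t) * q' = A\<^sup>2 * q + 2 * A * (A * B) * y + (A * B)\<^sup>2 * n
            + A * (A * C) * (2 * s + 1) + 2 * (A * B) * (A * C) * t"
        proof -
          have "A / t * q' = Q" using that t by (simp add: field_simps)
          then show ?thesis unfolding Q_def by algebra
        qed
        moreover have "A * (A / t) * y + A * B * (A / t) * n + A * C * (A / t) * t = 0"
          using C by algebra
        ultimately show ?thesis
          using that u t b by (simp add: P)
      qed
      consider "n \<noteq> 0" | "n = 0" "Q \<noteq> 0" | "n = 0" "Q = 0" by blast
      then show ?thesis
      proof cases
        case 1
        have "rebase (n / t) (n / t * B) (n / t * C) 0 (n / t / t) 0 0 P (label_coeffs (N14 (Q * t * t / n)))"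
          unfolding label_coeffs.simps using 1 t by (intro main) (auto simp: field_simps)
        then show ?thesis by blast
      next
        case 2
        have "rebase (Q * t) (Q * t * B) (Q * t * C) 0 (Q * t / t) 0 0 P (label_coeffs N12)"
          unfolding label_coeffs.simps using 2 t by (intro main) auto
        then show ?thesis by blast
      next
        case 3
        have "rebase 1 (1 * B) (1 * C) 0 (1 / t) 0 0 P (label_coeffs N13)"
          unfolding label_coeffs.simps using 3 t by (intro main) auto
        then show ?thesis by blast
      qed
    next
      case t: True
      have bn: "b * n = s * (2 * s + 1)" using nov u t by simp
      consider "n \<noteq> 0" "s = 0" | "n \<noteq> 0" "s = -1/2" | "n \<noteq> 0" "s \<noteq> 0" "2 * s + 1 \<noteq> 0"
        | "n = 0" "s = 0" | "n = 0" "s = -1/2"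
      proof -
        have "s = -1/2" if "2 * s + 1 = 0"
          using that by (simp add: field_simps add_eq_0_iff)
        then show ?thesis using bn that by fastforce
      qed
      then show ?thesis
      proof cases
        case 1
        then have b: "b = 0" using bn by simp
        have main: "rebase A (- A * y / n) (- (A * q - A * y\<^sup>2 / n)) 0 (A\<^sup>2 / n) 0 0 P (Coeffs 0 0 0 0 1 p' 0 0)"
          if "A \<noteq> 0" "A * p' = p * n - y" for A p'
        proof -
          have "A * (A\<^sup>2 / n) * p' = A\<^sup>2 / n * (A * p')" by simp
          also have "\<dots> = A\<^sup>2 * p + A * (- A * y / n)"
            unfolding that(2) using 1 by (simp add: field_simps power2_eq_square)
          finally show ?thesis
            using 1 u t b that(1) by (simp add: P field_simps power2_eq_square)
        qed
        show ?thesis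
        proof (cases "p * n - y = 0")
          case True
          have "rebase 1 (- 1 * y / n) (- (1 * q - 1 * y\<^sup>2 / n)) 0 (1\<^sup>2 / n) 0 0 P (label_coeffs (N8 0))"
            using main[of 1 0] True by simp
          then show ?thesis by blast
        next
          case False
          then show ?thesis
            using main[of "p * n - y" 1] by (metis label_coeffs.simps(9) mult.right_neutral)
        qed
      next
        case 2
        then have b: "b = 0" using bn by simp
        \<comment> \<open>\<open>R\<close> is the value of \<open>q\<close> once \<open>p\<close> and \<open>y\<close> have been killed. When it is nonzero, \<open>N11\<close> results,
          whose table has \<open>p = 1\<close>, \<open>q = 0\<close> in place of \<open>p = 0\<close>, \<open>q = 1\<close>; the scaling by \<open>A\<close> multiplies \<open>q\<close>
          by the inverse of a square, which is why a square root is needed.\<close>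
        define R where "R = q + 2 * p * y + p\<^sup>2 * n"
        show ?thesis
        proof (cases "R = 0")
          case True
          have "rebase 1 p 0 0 (1 / n) (- 2 * (y + p * n) / n) 0 P (label_coeffs (N8 (-1/2)))"
            using 2 u t b True unfolding R_def by (simp add: P) (simp add: field_simps power2_eq_square)
          then show ?thesis by blast
        next
          case False
          define A where "A = csqrt (n * R)"
          have A2: "A\<^sup>2 = n * R" by (simp add: A_def)
          then have A: "A \<noteq> 0" using 2 False by auto
          define B F where "B = A * p - R" and "F = - 2 * R * (A * y + B * n) / A"
          have F: "A * F = - 2 * R * (A * y + B * n)" using A by (simp add: F_def)
          have "A\<^sup>2 * q + 2 * A * B * y + B\<^sup>2 * n - A * F = 0"
            using F B_def R_def A2 by algebra
          moreover have "A * R * y + B * R * n + A * F / 2 = 0"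
            unfolding F by (simp add: field_simps)
          moreover have "A * R = A\<^sup>2 * p - A * B"
            unfolding B_def by algebra
          ultimately have "rebase A B 0 0 R F 0 P (label_coeffs N11)"
            using 2 u t b A A2 False by (simp add: P mult.commute)
          then show ?thesis by blast
        qed
      next
        case 3
        define F where "F = - (p - y * (4 * s + 1) / n) / (2 * s\<^sup>2)"
        define B where "B = F * s - y / n"
        define C where "C = - (q + 2 * B * y + B\<^sup>2 * n) / (2 * s + 1)"
        have C: "C * (2 * s + 1) = - (q + 2 * B * y + B\<^sup>2 * n)"
          using 3 by (simp add: C_def)
        have F: "2 * s\<^sup>2 * F = - (p - y / n * (4 * s + 1))"
          using 3 by (simp add: F_def)
        have "p + B * (4 * s + 1) - F * (b * n) = 0"
          using F bn B_def by algebra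
        moreover have "b * n = 2 * s\<^sup>2 + s"
          using bn by algebra
        moreover have "y / n + B * (1 / n) * n - F * s = 0"
          using 3 by (simp add: B_def)
        ultimately have "rebase 1 B C 0 (1 / n) F 0 P (label_coeffs (N8 s))"
          using 3 u t C by (simp add: P field_simps)
        then show ?thesis by blast
      next
        case 4
        define A where "A = (if y = 0 then 1 else y)"
        define E where "E = (if b = 0 then 1 else A\<^sup>2 * b)"
        have "A \<noteq> 0" "E \<noteq> 0" by (simp_all add: A_def E_def)
        then have main: "rebase A (- A * p) (2 * A * p * y - A * q) 0 E 0 0 P (Coeffs 0 0 0 b' 0 0 0 y')"
          if "E * b' = A\<^sup>2 * b" "A * y' = y" for b' y'
          using that 4 u t by (simp add: P power2_eq_square algebra_simps)
        obtain N where "label_coeffs N = Coeffs 0 0 0 (if b = 0 then 0 else 1) 0 0 0 (if y = 0 then 0 else 1)"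
          by (cases "b = 0"; cases "y = 0"; metis label_coeffs.simps(1-4))
        moreover have "rebase A (- A * p) (2 * A * p * y - A * q) 0 E 0 0 P \<dots>"
          by (rule main) (auto simp: A_def E_def)
        ultimately show ?thesis by metis
      next
        case 5
        show ?thesis
        proof (cases "b = 0")
          case False
          define F B where "F = - 2 * b * y" and "B = p - F"
          have "rebase 1 B 0 0 b F (q + 2 * B * y) P (label_coeffs N7)"
            using 5 u t False by (simp add: P F_def B_def)
          then show ?thesis by blast
        next
          case True
          define R where "R = q + 2 * p * y"
          show ?thesis
          proof (cases "R = 0")
            case False
            have "rebase 1 p 0 0 R (- 2 * R * y) 0 P (label_coeffs N6)"
              using 5 u t True False unfolding R_def by (simp add: P) (simp add: field_simps)
            then show ?thesis by blast
          next
            case R: True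
            have "rebase 1 p 0 0 1 (- 2 * y) 0 P (label_coeffs N5)"
              using 5 u t True R by (simp add: P R_def)
            then show ?thesis by blast
          qed
        qed
      qed
    qed
  qed
qed

section \<open>The classification\<close>

lemma novikov_h2_isomorphic_label:
  fixes scale :: "complex \<Rightarrow> 'a::ab_group_add \<Rightarrow> 'a"
  assumes nov: "novikov_algebra scale mul"
    and iso: "algebra_isomorphic scale (lie_bracket mul) (*s) h2_bracket"
  shows "\<exists>N. algebra_isomorphic scale mul (*s) (novikov_mult N)"
proof -
  obtain \<phi> where lin: "Vector_Spaces.linear scale (*s) \<phi>" and "bij \<phi>"
    and hom: "\<And>x y. \<phi> (lie_bracket mul x y) = h2_bracket (\<phi> x) (\<phi> y)"
    using iso unfolding algebra_isomorphic_def by blast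
  interpret \<phi>: Vector_Spaces.linear scale "(*s)" \<phi> by (fact lin)
  define m where "m x y = \<phi> (mul (inv \<phi> x) (inv \<phi> y))" for x y
  have \<phi>m: "\<phi> (mul x y) = m (\<phi> x) (\<phi> y)" for x y
    using \<open>bij \<phi>\<close> by (simp add: m_def bij_is_inj)
  have "algebra_isomorphic scale mul (*s) m"
    unfolding algebra_isomorphic_def using lin \<open>bij \<phi>\<close> \<phi>m by blast
  moreover have "novikov_algebra (*s) m"
    by (rule novikov_algebra_transport[where ?m2.0 = m, OF nov lin \<open>bij \<phi>\<close> \<phi>m])
  moreover have "lie_bracket m = h2_bracket"
  proof (intro ext)
    fix x y
    obtain x' y' where "x = \<phi> x'" "y = \<phi> y'"
      using \<open>bij \<phi>\<close> by (metis bij_pointE)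
    then show "lie_bracket m x y = h2_bracket x y"
      using hom[of x' y'] by (simp add: lie_bracket_def \<phi>.diff \<phi>m)
  qed
  ultimately obtain P where P: "algebra_isomorphic scale mul (*s) (coeff_mult P)" "novikov_coeffs P"
    using novikov_h2_eq_coeff_mult[of m] by blast
  then obtain N where "algebra_isomorphic (*s) (coeff_mult (label_coeffs N)) (*s) (coeff_mult P)"
    using exists_label coeff_mult_isomorphic_iff by blast
  then have "algebra_isomorphic (*s) (coeff_mult P) (*s) (novikov_mult N)"
    unfolding novikov_mult_eq_coeff_mult by (rule algebra_isomorphic_sym)
  with P(1) show ?thesis
    using algebra_isomorphic_trans by blast
qed

theorem mainTheorem5:
  shows "(\<forall>(scale :: complex \<Rightarrow> 'a::ab_group_add \<Rightarrow> 'a) mul.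
            novikov_algebra scale mul \<and>
            algebra_isomorphic scale (lie_bracket mul) (*s) h2_bracket \<longrightarrow>
            (\<exists>!N. algebra_isomorphic scale mul (*s) (novikov_mult N)))
       \<and> (\<forall>N N'. N \<noteq> N' \<longrightarrow>
            \<not> algebra_isomorphic (*s) (novikov_mult N) (*s) (novikov_mult N'))
       \<and> (\<forall>N. novikov_algebra (*s) (novikov_mult N) \<and>
            algebra_isomorphic (*s) (lie_bracket (novikov_mult N)) (*s) h2_bracket)"
proof (intro conjI allI impI)
  have distinct: "N = N'" if "algebra_isomorphic (*s) (novikov_mult N) (*s) (novikov_mult N')" for N N'
    using that rebase_label_coeffs_imp_eq
    unfolding novikov_mult_eq_coeff_mult coeff_mult_isomorphic_iff by metis
  {
    fix N N' :: novikov_label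
    assume "N \<noteq> N'"
    with distinct show "\<not> algebra_isomorphic (*s) (novikov_mult N) (*s) (novikov_mult N')" by blast
  }
  fix scale :: "complex \<Rightarrow> 'a \<Rightarrow> 'a" and mul
  assume *: "novikov_algebra scale mul \<and> algebra_isomorphic scale (lie_bracket mul) (*s) h2_bracket"
  then obtain N where N: "algebra_isomorphic scale mul (*s) (novikov_mult N)"
    using novikov_h2_isomorphic_label by blast
  moreover have "N' = N" if "algebra_isomorphic scale mul (*s) (novikov_mult N')" for N'
    by (rule distinct, rule algebra_isomorphic_trans[OF algebra_isomorphic_sym[OF that] N])
  ultimately show "\<exists>!N. algebra_isomorphic scale mul (*s) (novikov_mult N)"
    by blast
next
  fix N
  show "novikov_algebra (*s) (novikov_mult N)"
    unfolding novikov_mult_eq_coeff_mult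
    by (intro novikov_algebra_coeff_mult novikov_coeffs_label)
  have "Vector_Spaces.linear (*s) (*s) (\<lambda>x :: complex ^ 4. x)"
    by (simp add: linear_vec_iff)
  then show "algebra_isomorphic (*s) (lie_bracket (novikov_mult N)) (*s) h2_bracket"
    unfolding novikov_mult_eq_coeff_mult lie_bracket_coeff_mult algebra_isomorphic_def
    by (intro exI[of _ "\<lambda>x. x"]) (simp add: bij_def inj_def)
qed

end
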